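(* Let $H$ be a graph, possibly with loops, and let $G$ be an $H$-colored complete graph of order $n$ with $4\le n<9$, such that for every $x\in V(G)$ the graph $G_x$ is a complete $k_x$-partite graph for some $k_x\in\mathbb{N}$. Suppose that (1) for every $x\in V(G)$, $k_x\ge \frac{n+1}{2}$, and (2) $G$ does not contain a cycle of length $4$ with exactly $3$ obstructions. Then each vertex of $G$ is contained in an $H$-cycle of length $4$.
   Context: All graphs are finite; $G$ is simple. An $H$-coloring of $G$ is a function $c:E(G)\to V(H)$; $G$ is then called $H$-colored. A cycle $(v_1,\dots,v_k,v_1)$ of $G$ is an $H$-cycle if $(c(v_1v_2),\dots,c(v_{k-1}v_k),c(v_kv_1),c(v_1v_2))$ is a walk in $H$ (consecutive colors must be adjacent in $H$, where a loop at a color allows that color to be repeated). For a vertex $x$ of $G$, $G_x$ is the graph whose vertex set is the set of edges of $G$ incident with $x$, two distinct such edges $a,b$ being adjacent in $G_x$ iff $c(a)c(b)\in E(H)$. A complete $k$-partite graph is one whose vertex set is partitioned into $k$ nonempty independent sets with all edges between distinct parts present. For a cycle $(x_1,\dots,x_{m},x_1)$, a vertex $x_i$ is an obstruction of it if $c(x_{i-1}x_i)c(x_ix_{i+1})\notin E(H)$ (indices modulo $m$). *)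

theory Defs
  imports Complex_Main "HOL-Library.Disjoint_Sets" "HOL-Library.FuncSet"
begin

text \<open>
  Edges are unordered pairs \<open>{u, v}\<close>; a singleton edge \<open>{u, u} = {u}\<close> is a loop at \<open>u\<close>.
\<close>

record 'v ugraph =
  verts :: "'v set"
  edges :: "'v set set"

definition finite_graph :: "'v ugraph \<Rightarrow> bool" where
  "finite_graph G \<longleftrightarrow>
     finite (verts G) \<and> (\<forall>e\<in>edges G. \<exists>u\<in>verts G. \<exists>v\<in>verts G. e = {u, v})"

definition simple_graph :: "'v ugraph \<Rightarrow> bool" where
  "simple_graph G \<longleftrightarrow> finite_graph G \<and> (\<forall>u. {u} \<notin> edges G)"

definition complete_graph :: "'v ugraph \<Rightarrow> bool" where
  "complete_graph G \<longleftrightarrow>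
     simple_graph G \<and> (\<forall>u\<in>verts G. \<forall>v\<in>verts G. u \<noteq> v \<longrightarrow> {u, v} \<in> edges G)"

definition independent_set :: "'v ugraph \<Rightarrow> 'v set \<Rightarrow> bool" where
  "independent_set G A \<longleftrightarrow> A \<subseteq> verts G \<and> (\<forall>u\<in>A. \<forall>v\<in>A. {u, v} \<notin> edges G)"

text \<open>The parts are nonempty by definition of \<open>partition_on\<close>.\<close>

definition complete_partite :: "nat \<Rightarrow> 'v ugraph \<Rightarrow> bool" where
  "complete_partite k G \<longleftrightarrow> simple_graph G \<and>
     (\<exists>P. partition_on (verts G) P \<and> card P = k \<and>
        (\<forall>A\<in>P. independent_set G A) \<and>
        (\<forall>A\<in>P. \<forall>B\<in>P. A \<noteq> B \<longrightarrow> (\<forall>u\<in>A. \<forall>v\<in>B. {u, v} \<in> edges G)))"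

definition walk :: "'v ugraph \<Rightarrow> 'v list \<Rightarrow> bool" where
  "walk G ws \<longleftrightarrow> ws \<noteq> [] \<and> set ws \<subseteq> verts G \<and>
     (\<forall>i. Suc i < length ws \<longrightarrow> {ws ! i, ws ! Suc i} \<in> edges G)"

definition cyc_edge :: "'v list \<Rightarrow> nat \<Rightarrow> 'v set" where
  "cyc_edge xs i = {xs ! (i mod length xs), xs ! (Suc i mod length xs)}"

text \<open>
  The closed walk \<open>(x\<^sub>1, \<dots>, x\<^sub>m, x\<^sub>1)\<close> is represented by \<open>[x\<^sub>1, \<dots>, x\<^sub>m]\<close>, without
  repeating the first vertex, so the length of the cycle is the length of the list.
\<close>

definition is_cycle :: "'v ugraph \<Rightarrow> 'v list \<Rightarrow> bool" where
  "is_cycle G xs \<longleftrightarrow> 3 \<le> length xs \<and> distinct xs \<and> set xs \<subseteq> verts G \<and>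
     (\<forall>i<length xs. cyc_edge xs i \<in> edges G)"

definition is_coloring :: "'h ugraph \<Rightarrow> 'v ugraph \<Rightarrow> ('v set \<Rightarrow> 'h) \<Rightarrow> bool" where
  "is_coloring H G c \<longleftrightarrow> c \<in> edges G \<rightarrow> verts H"

text \<open>
  The index runs up to and including \<open>length xs\<close>, so that the colour of the first edge is
  repeated at the end and the transition at the first vertex is also checked.
\<close>

definition is_H_cycle :: "'h ugraph \<Rightarrow> 'v ugraph \<Rightarrow> ('v set \<Rightarrow> 'h) \<Rightarrow> 'v list \<Rightarrow> bool" where
  "is_H_cycle H G c xs \<longleftrightarrow> is_cycle G xs \<and>
     walk H (map (\<lambda>i. c (cyc_edge xs i)) [0..<Suc (length xs)])"

definition color_graph_at :: "'h ugraph \<Rightarrow> 'v ugraph \<Rightarrow> ('v set \<Rightarrow> 'h) \<Rightarrow> 'v \<Rightarrow> 'v set ugraph" where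
  "color_graph_at H G c x = \<lparr>
     verts = {e \<in> edges G. x \<in> e},
     edges = {{a, b} | a b. a \<in> edges G \<and> x \<in> a \<and> b \<in> edges G \<and> x \<in> b \<and>
                            a \<noteq> b \<and> {c a, c b} \<in> edges H}\<rparr>"

text \<open>
  With \<open>m = length xs\<close>, the edges of the cycle at \<open>xs ! i\<close> are those of index
  \<open>i + m - 1\<close> (modulo \<open>m\<close>) and \<open>i\<close>.
\<close>

definition obstructions :: "'h ugraph \<Rightarrow> ('v set \<Rightarrow> 'h) \<Rightarrow> 'v list \<Rightarrow> 'v set" where
  "obstructions H c xs =
     {xs ! i | i. i < length xs \<and>
        {c (cyc_edge xs (i + length xs - 1)), c (cyc_edge xs i)} \<notin> edges H}"

end

theory Submission imports Defs begin

text \<open>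
  Fix a vertex \<open>x\<close> and suppose that every 4-cycle \<open>(x, a, y, b)\<close> has an obstruction.
  At each vertex the \<open>n - 1\<close> incident edges fall into at least \<open>(n + 1) / 2\<close> parts, so the excess
  of edges over parts is at most \<open>e = (n - 3) div 2\<close>, which limits the number of obstructing
  pairs of edges there. For each \<open>y\<close>, the ordered pairs \<open>(a, b)\<close> not obstructed at \<open>a\<close> or \<open>b\<close> must all
  be obstructed at \<open>y\<close> or at \<open>x\<close>. Summing over \<open>y\<close> contradicts these limits; only \<open>n = 7\<close> is
  tight, where a cycle obstructed at both \<open>x\<close> and \<open>a\<close> decides.
\<close>

section \<open>Ordered pairs inside the parts of a partition\<close>

definition off_diag :: "'a set \<Rightarrow> ('a \<times> 'a) set" where
  "off_diag A = {(a, b). a \<in> A \<and> b \<in> A \<and> a \<noteq> b}"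

lemma finite_off_diag: "finite A \<Longrightarrow> finite (off_diag A)"
  by (rule finite_subset[of _ "A \<times> A"]) (auto simp: off_diag_def)

lemma card_off_diag:
  assumes "finite A"
  shows "card (off_diag A) = card A * (card A - 1)"
proof -
  have "off_diag A = (SIGMA a:A. A - {a})"
    by (auto simp: off_diag_def)
  then show ?thesis
    using assms by (simp add: card_SigmaI)
qed

text \<open>The map s -> s * (s + 1) is superadditive on naturals: the cross term 2 * s * t is
  nonnegative. Hence spreading a given excess over several parts never yields more pairs than
  putting it all into one part.\<close>

lemma sum_mult_Suc_le:
  fixes f :: "'a \<Rightarrow> nat"
  assumes "finite A"
  shows "(\<Sum>a\<in>A. f a * (f a + 1)) \<le> sum f A * (sum f A + 1)"
  using assms by (induction A rule: finite_induct) (auto simp: algebra_simps)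

text \<open>Give each part \<open>B\<close> the excess \<open>card B - 1\<close>; these sum to
  \<open>card U - card P\<close>, at most \<open>e\<close>. The part \<open>X\<close> uses
  \<open>t\<close> of this, leaving at most \<open>e - t\<close> for the others, where a part of
  excess s has s * (s + 1) ordered pairs. Superadditivity bounds their total.\<close>

lemma partition_on_card_off_diag:
  assumes fin: "finite U" and part: "partition_on U P" and X: "X \<in> P" and x: "x \<in> X"
    and e: "card U \<le> card P + e"
  defines "t \<equiv> card (X - {x})"
  shows "t \<le> e"
    and "card (off_diag (X - {x}) \<union> (\<Union>B\<in>P - {X}. off_diag B)) \<le> t * (t - 1) + (e - t) * (e - t + 1)"
proof -
  have finP: "finite P"
    using fin part by (rule finite_elements)
  have finB: "finite B" if "B \<in> P" for B
    using that fin partition_onD1[OF part] by (auto intro: finite_subset[of B U])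
  have pos: "card B = (card B - 1) + 1" if "B \<in> P" for B
    using that finB part card_gt_0_iff[of B] by (auto simp: partition_on_def)
  have "card U = (\<Sum>B\<in>P. card B)"
    using part finB by (metis card_Union_disjoint partition_onD1 partition_onD2 disjoint_def pairwise_def disjnt_def)
  also have "\<dots> = (\<Sum>B\<in>P. (card B - 1) + 1)"
    using pos by (intro sum.cong) auto
  also have "\<dots> = (\<Sum>B\<in>P. card B - 1) + card P"
    by (simp only: sum.distrib) simp
  finally have "(\<Sum>B\<in>P. card B - 1) \<le> e"
    using e by simp
  moreover have "(\<Sum>B\<in>P. card B - 1) = t + (\<Sum>B\<in>P - {X}. card B - 1)"
    using finP X x finB by (simp add: sum.remove t_def)
  ultimately have te: "t + (\<Sum>B\<in>P - {X}. card B - 1) \<le> e"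
    by simp
  then show "t \<le> e" by simp
  have "card (\<Union>B\<in>P - {X}. off_diag B) \<le> (\<Sum>B\<in>P - {X}. card (off_diag B))"
    using finP by (intro card_UN_le) auto
  also have "\<dots> = (\<Sum>B\<in>P - {X}. (card B - 1) * (card B - 1 + 1))"
    using finB pos by (intro sum.cong) (auto simp: card_off_diag)
  also have "\<dots> \<le> (\<Sum>B\<in>P - {X}. card B - 1) * ((\<Sum>B\<in>P - {X}. card B - 1) + 1)"
    using finP by (intro sum_mult_Suc_le) auto
  also have "\<dots> \<le> (e - t) * (e - t + 1)"
    using te by (intro mult_mono) auto
  finally have "card (\<Union>B\<in>P - {X}. off_diag B) \<le> (e - t) * (e - t + 1)" .
  moreover have "card (off_diag (X - {x})) = t * (t - 1)"
    using finB[OF X] by (simp add: card_off_diag t_def)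
  ultimately show "card (off_diag (X - {x}) \<union> (\<Union>B\<in>P - {X}. off_diag B)) \<le> t * (t - 1) + (e - t) * (e - t + 1)"
    using card_Un_le[of "off_diag (X - {x})" "\<Union>B\<in>P - {X}. off_diag B"] by linarith
qed

text \<open>Two vertices of a complete multipartite graph are nonadjacent exactly when they share a
  part, so the partition bounds become bounds on nonadjacent pairs, with \<open>t\<close> the number
  of other vertices in the part of \<open>x\<close>.\<close>

lemma complete_partite_nonadjacent:
  assumes G: "complete_partite k G" and e: "card (verts G) \<le> k + e" and x: "x \<in> verts G"
  defines "t \<equiv> card {b \<in> verts G - {x}. {x, b} \<notin> edges G}"
  shows "t \<le> e"
    and "card {(a, b). (a, b) \<in> off_diag (verts G - {x}) \<and> {a, b} \<notin> edges G}
           \<le> t * (t - 1) + (e - t) * (e - t + 1)"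
proof -
  have fin: "finite (verts G)"
    using G by (simp add: complete_partite_def simple_graph_def finite_graph_def)
  obtain P where P: "partition_on (verts G) P" "card P = k"
    and indep: "\<forall>A\<in>P. independent_set G A"
    and joined: "\<forall>A\<in>P. \<forall>B\<in>P. A \<noteq> B \<longrightarrow> (\<forall>u\<in>A. \<forall>v\<in>B. {u, v} \<in> edges G)"
    using G by (auto simp only: complete_partite_def)
  have U: "\<Union>P = verts G"
    using P(1) by (auto simp: partition_on_def)
  obtain X where X: "X \<in> P" "x \<in> X"
    using U x by auto
  have "{b \<in> verts G - {x}. {x, b} \<notin> edges G} = X - {x}"
  proof (intro equalityI subsetI)
    fix b assume b: "b \<in> {b \<in> verts G - {x}. {x, b} \<notin> edges G}"
    then obtain B where "B \<in> P" "b \<in> B"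
      using U by auto
    moreover from this have "B = X"
      using b joined X by auto
    ultimately show "b \<in> X - {x}"
      using b by simp
  next
    fix b assume "b \<in> X - {x}"
    then show "b \<in> {b \<in> verts G - {x}. {x, b} \<notin> edges G}"
      using indep X U by (auto simp: independent_set_def)
  qed
  then have t: "t = card (X - {x})"
    by (simp add: t_def)
  note bounds = partition_on_card_off_diag[OF fin P(1) X, of e, folded t]
  show "t \<le> e"
    using bounds(1) e P(2) by simp
  have finP: "finite P"
    using fin P(1) by (rule finite_elements)
  have finB: "finite B" if "B \<in> P" for B
    using that fin U by (auto intro: finite_subset[of B "verts G"])
  have "{(a, b). (a, b) \<in> off_diag (verts G - {x}) \<and> {a, b} \<notin> edges G}
      \<subseteq> off_diag (X - {x}) \<union> (\<Union>B\<in>P - {X}. off_diag B)"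
  proof clarify
    fix a b
    assume ab: "(a, b) \<in> off_diag (verts G - {x})" "{a, b} \<notin> edges G"
      "(a, b) \<notin> (\<Union>B\<in>P - {X}. off_diag B)"
    then have "a \<in> \<Union>P" "b \<in> \<Union>P"
      using U by (auto simp: off_diag_def)
    then obtain A B where "A \<in> P" "a \<in> A" "B \<in> P" "b \<in> B"
      by blast
    moreover from this have "A = B"
      using ab(2) joined by fastforce
    ultimately show "(a, b) \<in> off_diag (X - {x})"
      using ab by (auto simp: off_diag_def)
  qed
  then have "card {(a, b). (a, b) \<in> off_diag (verts G - {x}) \<and> {a, b} \<notin> edges G}
      \<le> card (off_diag (X - {x}) \<union> (\<Union>B\<in>P - {X}. off_diag B))"
    using finP finB X by (intro card_mono finite_UnI finite_UN_I finite_off_diag) auto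
  also have "\<dots> \<le> t * (t - 1) + (e - t) * (e - t + 1)"
    using bounds(2) e P(2) by simp
  finally show "card {(a, b). (a, b) \<in> off_diag (verts G - {x}) \<and> {a, b} \<notin> edges G}
      \<le> t * (t - 1) + (e - t) * (e - t + 1)" .
qed

section \<open>Obstructed transitions at a vertex of the coloured complete graph\<close>

text \<open>An obstruction at \<open>v\<close> expressed through the neighbours \<open>a\<close>,
  \<open>b\<close> instead of edges, so that counting can treat it as a ternary relation on
  vertices. Equal colours give a singleton, that is, a loop test.\<close>

definition clash :: "'h ugraph \<Rightarrow> ('v set \<Rightarrow> 'h) \<Rightarrow> 'v \<Rightarrow> 'v \<Rightarrow> 'v \<Rightarrow> bool" where
  "clash H c v a b \<longleftrightarrow> {c {v, a}, c {v, b}} \<notin> edges H"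

lemma clash_commute: "clash H c v a b \<longleftrightarrow> clash H c v b a"
  by (simp add: clash_def insert_commute)

lemma complete_graph_edges:
  assumes "complete_graph G" "x \<in> verts G"
  shows "{e \<in> edges G. x \<in> e} = (\<lambda>u. {x, u}) ` (verts G - {x})"
proof -
  have "e \<in> (\<lambda>u. {x, u}) ` (verts G - {x})" if "e \<in> edges G" "x \<in> e" for e
    using that assms unfolding complete_graph_def simple_graph_def finite_graph_def
    by (metis (no_types, lifting) DiffI doubleton_eq_iff empty_iff image_eqI insert_absorb2 insert_iff)
  then show ?thesis
    using assms by (auto simp: complete_graph_def)
qed

lemma color_graph_at_edge_iff:
  assumes "complete_graph G" "x \<in> verts G" "u \<in> verts G - {x}" "v \<in> verts G - {x}" "u \<noteq> v"
  shows "{{x, u}, {x, v}} \<in> edges (color_graph_at H G c x) \<longleftrightarrow> \<not> clash H c x u v"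
proof -
  have uv: "{x, u} \<in> edges G" "{x, v} \<in> edges G" "{x, u} \<noteq> {x, v}"
    using assms by (auto simp: complete_graph_def doubleton_eq_iff)
  have "{{x, u}, {x, v}} \<in> edges (color_graph_at H G c x) \<longleftrightarrow> {c {x, u}, c {x, v}} \<in> edges H"
  proof
    assume "{{x, u}, {x, v}} \<in> edges (color_graph_at H G c x)"
    then obtain a b where eq: "{{x, u}, {x, v}} = {a, b}" and ab: "{c a, c b} \<in> edges H"
      by (auto simp only: color_graph_at_def ugraph.select_convs mem_Collect_eq)
    \<comment> \<open>Applying \<open>c\<close> to both sides as sets avoids deciding which of
      \<open>a\<close>, \<open>b\<close> is which edge.\<close>
    have "{c {x, u}, c {x, v}} = {c a, c b}"
      using arg_cong[OF eq, of "image c"] by simp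
    then show "{c {x, u}, c {x, v}} \<in> edges H"
      using ab by simp
  next
    assume "{c {x, u}, c {x, v}} \<in> edges H"
    then show "{{x, u}, {x, v}} \<in> edges (color_graph_at H G c x)"
      unfolding color_graph_at_def ugraph.select_convs mem_Collect_eq
      using uv by (intro exI[of _ "{x, u}"] exI[of _ "{x, v}"]) simp
  qed
  then show ?thesis
    by (simp add: clash_def)
qed

text \<open>The map \<open>u\<close> to \<open>{v, u}\<close> is a bijection from the other vertices
  of \<open>G\<close> onto the vertices of the colour graph at \<open>v\<close> and turns clashes
  into nonadjacency, so the multipartite bounds transfer.\<close>

lemma card_clash:
  assumes G: "complete_graph G" and v: "v \<in> verts G"
    and part: "complete_partite k (color_graph_at H G c v)"
    and e: "card (verts G) - 1 \<le> k + e" and u: "u \<in> verts G - {v}"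
  defines "t \<equiv> card {w \<in> verts G - {v, u}. clash H c v u w}"
  shows "t \<le> e"
    and "card {(a, b). (a, b) \<in> off_diag (verts G - {v, u}) \<and> clash H c v a b}
           \<le> t * (t - 1) + (e - t) * (e - t + 1)"
proof -
  let ?C = "color_graph_at H G c v"
  let ?E = "\<lambda>u. {v, u}"
  have inj: "inj_on ?E S" for S
    by (auto simp: inj_on_def doubleton_eq_iff)
  have verts: "verts ?C = ?E ` (verts G - {v})"
    using complete_graph_edges[OF G v] by (simp add: color_graph_at_def)
  have "card (verts ?C) \<le> k + e"
    using e v by (simp add: verts card_image[OF inj])
  note bounds = complete_partite_nonadjacent[OF part this, of "{v, u}"]
  have "{b \<in> verts ?C - {{v, u}}. {{v, u}, b} \<notin> edges ?C}
      = ?E ` {w \<in> verts G - {v, u}. clash H c v u w}"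
    using u color_graph_at_edge_iff[OF G v u]
    by (auto simp: verts doubleton_eq_iff image_iff)
  then have t: "t = card {b \<in> verts ?C - {{v, u}}. {{v, u}, b} \<notin> edges ?C}"
    by (simp add: t_def card_image[OF inj])
  show "t \<le> e"
    using bounds(1) u t verts by auto
  have sub: "map_prod ?E ?E ` {(a, b). (a, b) \<in> off_diag (verts G - {v, u}) \<and> clash H c v a b}
      \<subseteq> {(a, b). (a, b) \<in> off_diag (verts ?C - {{v, u}}) \<and> {a, b} \<notin> edges ?C}"
    using color_graph_at_edge_iff[OF G v]
    by (auto simp: verts off_diag_def doubleton_eq_iff)
  have "finite (verts ?C)"
    using part by (simp add: complete_partite_def simple_graph_def finite_graph_def)
  then have fin: "finite {(a, b). (a, b) \<in> off_diag (verts ?C - {{v, u}}) \<and> {a, b} \<notin> edges ?C}"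
    by (intro finite_subset[OF _ finite_off_diag[of "verts ?C"]]) (auto simp: off_diag_def)
  have "card {(a, b). (a, b) \<in> off_diag (verts G - {v, u}) \<and> clash H c v a b}
      = card (map_prod ?E ?E ` {(a, b). (a, b) \<in> off_diag (verts G - {v, u}) \<and> clash H c v a b})"
    by (rule card_image[symmetric], rule inj_on_subset[OF map_prod_inj_on[OF inj[of UNIV] inj[of UNIV]]]) auto
  also have "\<dots> \<le> card {(a, b). (a, b) \<in> off_diag (verts ?C - {{v, u}}) \<and> {a, b} \<notin> edges ?C}"
    using fin sub by (rule card_mono)
  also have "\<dots> \<le> t * (t - 1) + (e - t) * (e - t + 1)"
    using bounds(2) u unfolding t verts by auto
  finally show "card {(a, b). (a, b) \<in> off_diag (verts G - {v, u}) \<and> clash H c v a b}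
      \<le> t * (t - 1) + (e - t) * (e - t + 1)" .
qed

text \<open>Each hypothesis in \<open>free\<close> handles one vertex of the cycle; the one at
  \<open>x\<close> covers the wrap-around from the last edge back to the first.\<close>

lemma H_cycle4I:
  assumes G: "complete_graph G" and c: "is_coloring H G c"
    and V: "x \<in> verts G" "a \<in> verts G" "y \<in> verts G" "b \<in> verts G"
    and dist: "distinct [x, a, y, b]"
    and free: "\<not> clash H c x a b" "\<not> clash H c a x y" "\<not> clash H c y a b" "\<not> clash H c b x y"
  shows "is_H_cycle H G c [x, a, y, b]"
proof -
  have edges: "{x, a} \<in> edges G" "{a, y} \<in> edges G" "{y, b} \<in> edges G" "{b, x} \<in> edges G"
    using G V dist by (auto simp: complete_graph_def)
  have colors: "map (\<lambda>i. c (cyc_edge [x, a, y, b] i)) [0..<Suc (length [x, a, y, b])]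
      = [c {x, a}, c {a, y}, c {y, b}, c {b, x}, c {x, a}]"
    by (simp add: cyc_edge_def upt_rec)
  have "is_cycle G [x, a, y, b]"
    using edges V dist by (simp add: is_cycle_def cyc_edge_def All_less_Suc2)
  moreover have "walk H [c {x, a}, c {a, y}, c {y, b}, c {b, x}, c {x, a}]"
    using edges c free by (auto simp: walk_def is_coloring_def clash_def insert_commute All_less_Suc2)
  ultimately show ?thesis
    unfolding is_H_cycle_def colors by blast
qed

section \<open>Double counting over the vertex opposite \<open>x\<close>\<close>

text \<open>Colours are forgotten: only the relation \<open>R\<close> and the two bounds at each
  vertex enter. The bound on pairs leaves out \<open>u\<close> because it is used at
  \<open>y\<close> with \<open>u = x\<close>, where only pairs \<open>(a, b)\<close> avoiding
  \<open>x\<close> matter.\<close>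

lemma exists_unobstructed:
  fixes R :: "'v \<Rightarrow> 'v \<Rightarrow> 'v \<Rightarrow> bool" and V :: "'v set" and n e :: nat
  defines "t \<equiv> \<lambda>v u. card {w \<in> V - {v, u}. R v u w}"
  assumes fin: "finite V" and n: "card V = n" "4 \<le> n" "n < 9" and e: "e = (n - 3) div 2"
    and sym: "\<And>v a b. R v a b \<longleftrightarrow> R v b a"
    and t_le: "\<And>v u. v \<in> V \<Longrightarrow> u \<in> V - {v} \<Longrightarrow> t v u \<le> e"
    and pairs_le: "\<And>v u. v \<in> V \<Longrightarrow> u \<in> V - {v} \<Longrightarrow>
      card {(a, b). (a, b) \<in> off_diag (V - {v, u}) \<and> R v a b}
        \<le> t v u * (t v u - 1) + (e - t v u) * (e - t v u + 1)"
    and x: "x \<in> V"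
  shows "\<exists>a y b. {a, y, b} \<subseteq> V \<and> distinct [x, a, y, b] \<and>
    \<not> R x a b \<and> \<not> R a x y \<and> \<not> R y a b \<and> \<not> R b x y"
proof (rule ccontr)
  assume none: "\<not> ?thesis"
  \<comment> \<open>In a candidate cycle \<open>[x, a, y, b]\<close>, \<open>out\<close> and
    \<open>N\<close> are the two sides of one relation, obstruction at the middle vertex
    \<open>a\<close>. The set \<open>A y\<close> holds the middle vertices still usable for
    \<open>y\<close>; a pair from it can fail only at \<open>y\<close> (\<open>P y\<close>) or at
    \<open>x\<close> (\<open>Q' y\<close>).\<close>
  define W where "W = V - {x}"
  define out where "out a = {y \<in> W - {a}. R a x y}" for a
  define N where "N y = {a \<in> W. a \<noteq> y \<and> R a x y}" for y
  define A where "A y = W - {y} - N y" for y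
  define Q where "Q = {(a, b). (a, b) \<in> off_diag W \<and> R x a b}"
  define Q' where "Q' y = {q \<in> Q. fst q \<in> A y \<and> snd q \<in> A y}" for y
  define P where "P y = {(a, b). (a, b) \<in> off_diag (V - {y, x}) \<and> R y a b}" for y
  define f where "f s = s * (s - 1) + (e - s) * (e - s + 1)" for s
  have finW: "finite W" and cardW: "card W = n - 1"
    using fin n x by (simp_all add: W_def)
  have out: "card (out y) = t y x" if "y \<in> W" for y
    unfolding out_def t_def W_def by (rule arg_cong[where f = card]) auto
  have out_le: "card (out y) \<le> e" if "y \<in> W" for y
    using t_le[of y x] out[OF that] that x by (auto simp: W_def)
  have P_le: "card (P y) \<le> f (card (out y))" if "y \<in> W" for y
    using pairs_le[of y x] out[OF that] that x by (auto simp: W_def P_def f_def)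
  have finP: "finite (P y)" for y
    using fin by (intro finite_subset[OF _ finite_off_diag[of V]]) (auto simp: P_def off_diag_def)
  have finQ: "finite Q"
    using finW by (intro finite_subset[OF _ finite_off_diag[of W]]) (auto simp: Q_def)
  have Q_le: "card Q \<le> e * (e + 1)"
  proof -
    obtain u where u: "u \<in> W"
      using cardW n by fastforce
    define D where "D = {w \<in> V - {x, u}. R x u w}"
    define Z where "Z = {(a, b). (a, b) \<in> off_diag (V - {x, u}) \<and> R x a b}"
    have finD: "finite D"
      using fin by (simp add: D_def)
    have finZ: "finite Z"
      using fin by (intro finite_subset[OF _ finite_off_diag[of V]]) (auto simp: Z_def off_diag_def)
    have D: "card D = t x u" "card D \<le> e"
      using t_le[of x u] u x by (auto simp: D_def t_def W_def)
    \<comment> \<open>The vertex \<open>u\<close> is arbitrary: the assumed bound covers the pairs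
      avoiding it, and those containing it are counted twice through \<open>D\<close>.\<close>
    have "Q \<subseteq> {u} \<times> D \<union> D \<times> {u} \<union> Z"
      using sym u by (auto simp: Q_def Z_def D_def W_def off_diag_def)
    then have "card Q \<le> card ({u} \<times> D \<union> D \<times> {u} \<union> Z)"
      using finD finZ by (intro card_mono) auto
    also have "\<dots> \<le> card D + card D + card Z"
      using card_Un_le[of "{u} \<times> D \<union> D \<times> {u}" Z] card_Un_le[of "{u} \<times> D" "D \<times> {u}"]
      by (simp add: card_cartesian_product)
    also have "card Z \<le> f (card D)"
      using pairs_le[of x u] u x D by (auto simp: Z_def W_def f_def)
    also have "card D + card D + f (card D) \<le> e * (e + 1)"
    proof -
      \<comment> \<open>With t = \<open>card D\<close> the left side is t * (t + 1) + s * (s + 1),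
        so superadditivity applies again.\<close>
      obtain s where "e = card D + s"
        using D(2) le_Suc_ex by blast
      then show ?thesis
        by (cases "card D") (auto simp: f_def algebra_simps)
    qed
    finally show ?thesis by simp
  qed
  have cover: "off_diag (A y) \<subseteq> P y \<union> Q' y" if "y \<in> W" for y
  proof clarify
    fix a b
    assume ab: "(a, b) \<in> off_diag (A y)" "(a, b) \<notin> Q' y"
    then have "{a, y, b} \<subseteq> V" "distinct [x, a, y, b]" "\<not> R a x y" "\<not> R b x y" "\<not> R x a b"
      using that by (auto simp: off_diag_def A_def N_def Q_def Q'_def W_def)
    with none have "R y a b" by blast
    then show "(a, b) \<in> P y"
      using ab by (auto simp: P_def off_diag_def A_def W_def)
  qed
  \<comment> \<open>With \<open>j = card (A y)\<close>, the quadratic \<open>j * (j - 1)\<close> is replaced by the linear lower bound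
    \<open>2 * r * j - r * (r + 1)\<close>, valid for integers because \<open>(j - r)\<^sup>2 \<ge> j - r\<close>. It is sharp at the
    value \<open>j = r + 1\<close> attained when every \<open>card (N y)\<close> equals \<open>e\<close>.\<close>
  define r where "r = int n - 3 - int e"
  have local_bound: "2 * r * (int n - 2 - int (card (N y))) - r * (r + 1)
      \<le> int (f (card (out y))) + int (card (Q' y))" if y: "y \<in> W" for y
  proof -
    have finA: "finite (A y)"
      using finW by (simp add: A_def)
    have NW: "N y \<subseteq> W - {y}"
      by (auto simp: N_def)
    have "card (A y) = n - 2 - card (N y)"
      using NW finW y cardW by (simp add: A_def card_Diff_subset finite_subset[OF NW])
    moreover have "card (N y) \<le> n - 2"
      using card_mono[OF _ NW] finW y cardW by simp
    ultimately have j: "int (card (A y)) = int n - 2 - int (card (N y))"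
      using n by simp
    define i where "i = int (card (A y)) - r"
    have "card (A y) * (card (A y) - 1) \<le> card (P y \<union> Q' y)"
      using card_mono[OF _ cover[OF y]] finP finQ finA by (simp add: card_off_diag Q'_def)
    also have "\<dots> \<le> f (card (out y)) + card (Q' y)"
      using card_Un_le[of "P y" "Q' y"] P_le[OF y] by linarith
    finally have "int (card (A y) * (card (A y) - 1)) \<le> int (f (card (out y))) + int (card (Q' y))"
      by linarith
    moreover have "int (card (A y) * (card (A y) - 1)) = int (card (A y)) * (int (card (A y)) - 1)"
      by (cases "card (A y)") (auto simp: algebra_simps)
    moreover have "i \<le> i * i"
      using self_le_power[of i 2] by (cases "i \<le> 0") (auto simp: power2_eq_square intro: order_trans[of _ 0])
    then have "2 * r * int (card (A y)) - r * (r + 1) \<le> int (card (A y)) * (int (card (A y)) - 1)"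
      by (simp add: i_def algebra_simps)
    ultimately show ?thesis
      unfolding j[symmetric] by linarith
  qed
  have "(\<Sum>y\<in>W. card (N y)) = (\<Sum>y\<in>W. \<Sum>a\<in>{a \<in> W. a \<noteq> y \<and> R a x y}. 1)"
    by (simp add: N_def)
  also have "\<dots> = (\<Sum>a\<in>W. \<Sum>y\<in>{y \<in> W. a \<noteq> y \<and> R a x y}. 1)"
    using finW finW by (rule sum.swap_restrict)
  also have "\<dots> = (\<Sum>a\<in>W. card (out a))"
    unfolding out_def by (intro sum.cong refl) (auto intro!: arg_cong[where f = card])
  finally have sumN: "(\<Sum>y\<in>W. int (card (N y))) = (\<Sum>a\<in>W. int (card (out a)))"
    by (metis of_nat_sum)
  have "(\<Sum>y\<in>W. card (Q' y)) = (\<Sum>y\<in>W. \<Sum>q\<in>{q \<in> Q. fst q \<in> A y \<and> snd q \<in> A y}. 1)"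
    by (simp add: Q'_def)
  also have "\<dots> = (\<Sum>q\<in>Q. \<Sum>y\<in>{y \<in> W. fst q \<in> A y \<and> snd q \<in> A y}. 1)"
    using finW finQ by (rule sum.swap_restrict)
  finally have sumQ: "(\<Sum>y\<in>W. card (Q' y)) = (\<Sum>q\<in>Q. card {y \<in> W. fst q \<in> A y \<and> snd q \<in> A y})"
    by simp
  have Q_bound: "(\<Sum>y\<in>W. card (Q' y)) \<le> e * (e + 1) * B"
    if "\<And>a b. (a, b) \<in> Q \<Longrightarrow> card {y \<in> W. a \<in> A y \<and> b \<in> A y} \<le> B" for B
  proof -
    have "(\<Sum>y\<in>W. card (Q' y)) \<le> card Q * B"
      unfolding sumQ using that by (intro order_trans[OF sum_bounded_above[of _ _ B]]) auto
    also have "\<dots> \<le> e * (e + 1) * B"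
      using Q_le by (rule mult_right_mono) simp
    finally show ?thesis .
  qed
  have Q_bound1: "(\<Sum>y\<in>W. card (Q' y)) \<le> e * (e + 1) * (n - 3)"
  proof (rule Q_bound)
    fix a b assume "(a, b) \<in> Q"
    then have ab: "a \<in> W" "b \<in> W" "a \<noteq> b"
      by (auto simp: Q_def off_diag_def)
    \<comment> \<open>Membership in \<open>A y\<close> forces \<open>y\<close> to differ from both
      \<open>a\<close> and \<open>b\<close>.\<close>
    have "card {y \<in> W. a \<in> A y \<and> b \<in> A y} \<le> card (W - {a, b})"
      using finW by (intro card_mono) (auto simp: A_def)
    then show "card {y \<in> W. a \<in> A y \<and> b \<in> A y} \<le> n - 3"
      using ab finW cardW by (simp add: card_Diff_subset)
  qed
  have Q_bound2: "(\<Sum>y\<in>W. card (Q' y)) \<le> e * (e + 1) * (n - 2 - e)" if all: "\<forall>a\<in>W. card (out a) = e"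
  proof (rule Q_bound)
    fix a b assume "(a, b) \<in> Q"
    then have a: "a \<in> W"
      by (auto simp: Q_def off_diag_def)
    have fo: "finite (out a)" and na: "a \<notin> out a" and sub: "out a \<subseteq> W"
      using finW by (auto simp: out_def)
    \<comment> \<open>Membership of \<open>a\<close> in \<open>A y\<close> also excludes every
      \<open>y\<close> in \<open>out a\<close>, since these cycles are already obstructed at
      \<open>a\<close>.\<close>
    have "card {y \<in> W. a \<in> A y \<and> b \<in> A y} \<le> card (W - insert a (out a))"
      using finW a by (intro card_mono) (auto simp: A_def N_def out_def)
    also have "\<dots> = n - 2 - e"
      using fo na sub a all cardW by (simp add: card_Diff_subset)
    finally show "card {y \<in> W. a \<in> A y \<and> b \<in> A y} \<le> n - 2 - e" .
  qed
  \<comment> \<open>What \<open>Q' y\<close> must supply once the bound on \<open>P y\<close> is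
    subtracted, with \<open>card (N y)\<close> replaced by \<open>card (out y)\<close>. The
    replacement is valid only after summation: the lower bound is linear and both cardinalities have
    the same sum.\<close>
  define g where "g s = 2 * r * (int n - 2 - int s) - r * (r + 1) - int (f s)" for s
  have "(\<Sum>y\<in>W. 2 * r * (int n - 2 - int (card (N y))) - r * (r + 1))
      \<le> (\<Sum>y\<in>W. int (f (card (out y))) + int (card (Q' y)))"
    using local_bound by (rule sum_mono)
  moreover have "(\<Sum>y\<in>W. 2 * r * (int n - 2 - int (card (N y))) - r * (r + 1))
      = (\<Sum>y\<in>W. 2 * r * (int n - 2 - int (card (out y))) - r * (r + 1))"
    by (simp only: sum_subtractf sumN flip: sum_distrib_left)
  ultimately have g_sum: "(\<Sum>y\<in>W. g (card (out y))) \<le> int (\<Sum>y\<in>W. card (Q' y))"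
    by (simp add: g_def sum.distrib sum_subtractf)
  have g_ge: "int (n - 1) * B \<le> int (\<Sum>y\<in>W. card (Q' y))" if "\<And>s. s \<le> e \<Longrightarrow> B \<le> g s" for B
  proof -
    have "int (n - 1) * B = (\<Sum>y\<in>W. B)"
      by (simp add: cardW)
    also have "\<dots> \<le> (\<Sum>y\<in>W. g (card (out y)))"
      using out_le that by (intro sum_mono) auto
    finally show ?thesis
      using g_sum by linarith
  qed
  consider "n = 4" "e = 0" | "n = 5" "e = 1" | "n = 6" "e = 1" | "n = 7" "e = 2" | "n = 8" "e = 2"
    using n e by force
  then show False
  proof cases
    case 1
    \<comment> \<open>The constant is the minimum of \<open>g\<close> on \<open>{0..e}\<close>, as
      in the other cases except n = 7. Comparing n - 1 times it with \<open>Q_bound1\<close> gives 6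
      > 0, 8 > 4, 30 > 6 and 70 > 30 for n = 4, 5, 6, 8.\<close>
    have "2 \<le> g s" if "s \<le> e" for s
    proof -
      have "s = 0"
        using that 1 by arith
      then show ?thesis
        using 1 by (auto simp: g_def r_def f_def)
    qed
    from g_ge[OF this] show False
      using Q_bound1 1 by (simp del: of_nat_sum)
  next
    case 2
    have "2 \<le> g s" if "s \<le> e" for s
    proof -
      have "s = 0 \<or> s = 1"
        using that 2 by arith
      then show ?thesis
        using 2 by (auto simp: g_def r_def f_def)
    qed
    from g_ge[OF this] show False
      using Q_bound1 2 by (simp del: of_nat_sum)
  next
    case 3
    have "6 \<le> g s" if "s \<le> e" for s
    proof -
      have "s = 0 \<or> s = 1"
        using that 3 by arith
      then show ?thesis
        using 3 by (auto simp: g_def r_def f_def)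
    qed
    from g_ge[OF this] show False
      using Q_bound1 3 by (simp del: of_nat_sum)
  next
    case 4
    \<comment> \<open>The minimum 4 gives only 24 \<le> 24. If every \<open>card (out a)\<close> is
      2, \<open>Q_bound2\<close> lowers the right side to 18; otherwise some vertex contributes 8
      and the left side is at least 5 * 4 + 8 = 28.\<close>
    have g: "g 2 = 4" "\<And>s. s \<le> 1 \<Longrightarrow> g s = 8"
      using 4 by (auto simp: g_def r_def f_def le_Suc_eq)
    show False
    proof (cases "\<forall>a\<in>W. card (out a) = e")
      case True
      then show False
        using Q_bound2 g_sum g 4 cardW by (simp del: of_nat_sum)
    next
      case False
      then obtain a where a: "a \<in> W" "card (out a) \<noteq> 2"
        using 4 by auto
      then have "g (card (out a)) = 8"
        using g(2) out_le[of a] 4 by simp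
      moreover have "4 \<le> g (card (out y))" if "y \<in> W" for y
        using out_le[OF that] g 4 by (cases "card (out y) = 2") auto
      then have "(\<Sum>y\<in>W - {a}. 4) \<le> (\<Sum>y\<in>W - {a}. g (card (out y)))"
        by (intro sum_mono) auto
      ultimately have "28 \<le> (\<Sum>y\<in>W. g (card (out y)))"
        using a finW cardW 4 by (simp add: sum.remove[of W a])
      then show False
        using g_sum Q_bound1 4 by (simp del: of_nat_sum)
    qed
  next
    case 5
    have "10 \<le> g s" if "s \<le> e" for s
    proof -
      have "s = 0 \<or> s = 1 \<or> s = 2"
        using that 5 by arith
      then show ?thesis
        using 5 by (auto simp: g_def r_def f_def)
    qed
    from g_ge[OF this] show False
      using Q_bound1 5 by (simp del: of_nat_sum)
  qed
qed

section \<open>Application of the counting bound to the colour graphs\<close>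

theorem theorem3:
  fixes H :: "'h ugraph" and G :: "'v ugraph" and c :: "'v set \<Rightarrow> 'h"
    and n :: nat and k :: "'v \<Rightarrow> nat"
  assumes "finite_graph H"
    and "complete_graph G"
    and "is_coloring H G c"
    and "card (verts G) = n" and "4 \<le> n" and "n < 9"
    and "\<And>x. x \<in> verts G \<Longrightarrow> complete_partite (k x) (color_graph_at H G c x)"
    and "\<And>x. x \<in> verts G \<Longrightarrow> real (k x) \<ge> (real n + 1) / 2"
    and "\<not> (\<exists>xs. is_cycle G xs \<and> length xs = 4 \<and> card (obstructions H c xs) = 3)"
  shows "\<forall>x\<in>verts G. \<exists>xs. is_H_cycle H G c xs \<and> length xs = 4 \<and> x \<in> set xs"
proof
  fix x assume x: "x \<in> verts G"
  have fin: "finite (verts G)"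
    using assms(2) by (simp add: complete_graph_def simple_graph_def finite_graph_def)
  \<comment> \<open>The excess n - 1 - \<open>k v\<close> is an integer at most (n - 3) / 2, hence
    at most its floor.\<close>
  have k: "card (verts G) - 1 \<le> k v + (n - 3) div 2" if "v \<in> verts G" for v
  proof -
    have "n + 1 \<le> 2 * k v"
      using assms(8)[OF that] by (simp add: field_simps flip: of_nat_Suc of_nat_mult of_nat_add)
    then show ?thesis
      using assms(4,5) by presburger
  qed
  have "\<exists>a y b. {a, y, b} \<subseteq> verts G \<and> distinct [x, a, y, b] \<and>
    \<not> clash H c x a b \<and> \<not> clash H c a x y \<and> \<not> clash H c y a b \<and> \<not> clash H c b x y"
    using assms(2,7) k
    by (intro exists_unobstructed[OF fin assms(4-6) refl clash_commute _ _ x] card_clash)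
  then obtain a y b where "{a, y, b} \<subseteq> verts G" "distinct [x, a, y, b]"
    "\<not> clash H c x a b" "\<not> clash H c a x y" "\<not> clash H c y a b" "\<not> clash H c b x y"
    by blast
  then have "is_H_cycle H G c [x, a, y, b]"
    using x by (intro H_cycle4I[OF assms(2,3)]) auto
  then show "\<exists>xs. is_H_cycle H G c xs \<and> length xs = 4 \<and> x \<in> set xs"
    by (intro exI[of _ "[x, a, y, b]"]) simp
qed

end
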